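(* For every integer $n\geq 3$, the cycle $C_n$ on $n$ vertices satisfies $\chi_{td}(C_n)=4$ if $n\equiv 0\pmod 3$, and $\chi_{td}(C_n)=5$ otherwise.
   Context: Graphs are finite, simple and undirected. A total labeling of a graph $G$ is a function $f:V(G)\cup E(G)\to\mathbb{Z}^+$ (positive integers) such that $f(u)\neq f(v)$ for adjacent vertices $u,v$; $f(\{u,v\})\neq f(\{v,w\})$ for any two distinct incident edges $\{u,v\},\{v,w\}$; and $f(u)\neq f(\{u,v\})$ for every edge $\{u,v\}$ and incident vertex $u$. It is a $k$-total labeling if the maximum label assigned to any vertex or edge is $k$. A $k$-total difference labeling is a $k$-total labeling $f$ with $f(\{u,v\})=|f(u)-f(v)|$ for every edge $\{u,v\}$. The total difference chromatic number $\chi_{td}(G)$ is the smallest integer $k$ for which $G$ has a $k$-total difference labeling. *)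

theory Defs
  imports Main
begin

type_synonym 'a graph = "'a set \<times> 'a set set"

abbreviation verts :: "'a graph \<Rightarrow> 'a set" where "verts \<equiv> fst"
abbreviation edges :: "'a graph \<Rightarrow> 'a set set" where "edges \<equiv> snd"

definition finite_simple_graph :: "'a graph \<Rightarrow> bool" where
  "finite_simple_graph G \<longleftrightarrow>
     finite (verts G) \<and> (\<forall>e\<in>edges G. e \<subseteq> verts G \<and> card e = 2)"

text \<open>
  A labeling assigns a value to \<open>Inl u\<close> for each vertex \<open>u\<close> and to \<open>Inr e\<close> for each edge \<open>e\<close>.
  Values outside \<open>verts G <+> edges G\<close> are irrelevant.
\<close>

definition total_labeling :: "'a graph \<Rightarrow> ('a + 'a set \<Rightarrow> nat) \<Rightarrow> bool" where
  "total_labeling G f \<longleftrightarrow>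
     (\<forall>x \<in> verts G <+> edges G. 0 < f x) \<and>
     (\<forall>u v. {u, v} \<in> edges G \<longrightarrow> f (Inl u) \<noteq> f (Inl v)) \<and>
     (\<forall>e\<in>edges G. \<forall>e'\<in>edges G. e \<noteq> e' \<and> e \<inter> e' \<noteq> {} \<longrightarrow> f (Inr e) \<noteq> f (Inr e')) \<and>
     (\<forall>e\<in>edges G. \<forall>u\<in>e. f (Inl u) \<noteq> f (Inr e))"

definition k_total_labeling :: "nat \<Rightarrow> 'a graph \<Rightarrow> ('a + 'a set \<Rightarrow> nat) \<Rightarrow> bool" where
  "k_total_labeling k G f \<longleftrightarrow>
     total_labeling G f \<and> Max (f ` (verts G <+> edges G)) = k"

definition k_total_difference_labeling ::
    "nat \<Rightarrow> 'a graph \<Rightarrow> ('a + 'a set \<Rightarrow> nat) \<Rightarrow> bool" where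
  "k_total_difference_labeling k G f \<longleftrightarrow>
     k_total_labeling k G f \<and>
     (\<forall>u v. {u, v} \<in> edges G \<longrightarrow>
        int (f (Inr {u, v})) = \<bar>int (f (Inl u)) - int (f (Inl v))\<bar>)"

text \<open>
  The minimum is attained for every nonempty finite simple graph: labeling the vertices with
  distinct powers of 3 yields a total difference labeling.
\<close>

definition chi_td :: "'a graph \<Rightarrow> nat" where
  "chi_td G = (LEAST k. \<exists>f. k_total_difference_labeling k G f)"

text \<open>For \<open>n < 3\<close> this is not a cycle.\<close>

definition cycle_graph :: "nat \<Rightarrow> nat graph" where
  "cycle_graph n = ({..<n}, {{i, Suc i mod n} | i. i < n})"

lemma finite_simple_graph_cycle_graph:
  assumes "n \<ge> 3"
  shows "finite_simple_graph (cycle_graph n)"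
proof -
  have "i \<noteq> Suc i mod n" if "i < n" for i
    using that assms by (cases "Suc i = n") auto
  with assms show ?thesis
    by (auto simp: finite_simple_graph_def cycle_graph_def)
qed

end

theory Submission
  imports Defs
begin

text \<open>
  The edge labels are determined by the vertex labels, so a labeling of the cycle amounts to an
  \<open>n\<close>-periodic sequence all of whose windows of length three satisfy a local condition. With labels
  at most \<open>4\<close> the label \<open>2\<close> has only \<open>3\<close> as admissible neighbour while its two neighbours must
  differ, so it does not occur; three consecutive labels are then exactly \<open>1, 3, 4\<close> in some order,
  which needs the label \<open>4\<close> and gives the sequence period \<open>3\<close>, forcing \<open>3\<close> to divide \<open>n\<close>.
  Conversely, blocks \<open>1, 3, 4\<close> can be repeated and followed by one block \<open>1, 3, 2, 5\<close> or
  \<open>1, 3, 2, 5, 4\<close>.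
\<close>

text \<open>For consecutive vertex labels \<open>a\<close>, \<open>b\<close>, \<open>c\<close>: with
  positive labels, the factor-2 conditions keep the edge label \<open>|a - b|\<close> away from
  \<open>a\<close> and \<open>b\<close>, and the last two give
  \<open>|a - b| \<noteq> |b - c|\<close>. Positivity of \<open>b\<close> and the conditions on the
  pair \<open>b\<close>, \<open>c\<close> are left to the next window.\<close>

definition admissible :: "nat \<Rightarrow> nat \<Rightarrow> nat \<Rightarrow> bool" where
  "admissible a b c \<longleftrightarrow>
     0 < a \<and> a \<noteq> b \<and> a \<noteq> 2 * b \<and> b \<noteq> 2 * a \<and> a \<noteq> c \<and> a + c \<noteq> 2 * b"

text \<open>Indexing by all naturals lets \<open>m\<close> and \<open>Suc m\<close> name successive
  edges without a case split at the closing edge.\<close>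

lemma edges_cycle_graph:
  assumes "0 < n"
  shows "edges (cycle_graph n) = {{m mod n, Suc m mod n} | m. True}"
proof -
  have "\<exists>i<n. {m mod n, Suc m mod n} = {i, Suc i mod n}" for m
    using assms by (intro exI[of _ "m mod n"]) (simp add: mod_Suc_eq)
  moreover have "\<exists>m. {i, Suc i mod n} = {m mod n, Suc m mod n}" if "i < n" for i
    using that by (intro exI[of _ i]) simp
  ultimately show ?thesis
    unfolding cycle_graph_def snd_conv by blast
qed

lemma Suc_mod_neq:
  assumes "2 \<le> n"
  shows "Suc m mod n \<noteq> m mod n"
  using assms by (auto simp: mod_Suc)

lemma Suc_Suc_mod_neq:
  assumes "3 \<le> n"
  shows "Suc (Suc m) mod n \<noteq> m mod n"
  using assms by (auto simp: mod_Suc)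

lemma difference_labeling_imp_admissible:
  assumes "3 \<le> n" and f: "k_total_difference_labeling k (cycle_graph n) f"
  defines "b \<equiv> \<lambda>m. f (Inl (m mod n))"
  shows "admissible (b m) (b (Suc m)) (b (Suc (Suc m)))" and "b m \<le> k"
proof -
  let ?G = "cycle_graph n"
  let ?e = "\<lambda>m. {m mod n, Suc m mod n}"
  have n: "0 < n" using assms by simp
  have E: "?e m \<in> edges ?G" for m
    by (auto simp: edges_cycle_graph[OF n])
  have V: "m mod n \<in> verts ?G" for m
    using n by (simp add: cycle_graph_def)
  from f have tl: "total_labeling ?G f" and M: "Max (f ` (verts ?G <+> edges ?G)) = k"
    and diff: "\<And>u v. {u, v} \<in> edges ?G \<Longrightarrow>
      int (f (Inr {u, v})) = \<bar>int (f (Inl u)) - int (f (Inl v))\<bar>"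
    by (auto simp: k_total_difference_labeling_def k_total_labeling_def)
  have fe: "int (f (Inr (?e m))) = \<bar>int (b m) - int (b (Suc m))\<bar>" for m
    unfolding b_def by (rule diff[OF E])
  have pos: "0 < b m"
    unfolding b_def using tl V[of m] by (simp add: total_labeling_def InlI)
  have vv: "b m \<noteq> b (Suc m)"
    unfolding b_def using tl E[of m] by (simp add: total_labeling_def)
  have "\<forall>u\<in>?e m. f (Inl u) \<noteq> f (Inr (?e m))"
    using tl[unfolded total_labeling_def, THEN conjunct2, THEN conjunct2, THEN conjunct2]
    by (rule bspec) (rule E)
  then have ve: "b m \<noteq> f (Inr (?e m))" "b (Suc m) \<noteq> f (Inr (?e m))"
    by (simp_all add: b_def)
  \<comment> \<open>The two edges share \<open>Suc m mod n\<close>; their outer ends differ because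
    \<open>3 \<le> n\<close>.\<close>
  have "?e m \<noteq> ?e (Suc m)"
    using Suc_Suc_mod_neq[OF assms(1), of m] Suc_mod_neq[of n m] assms(1)
    by (auto simp: doubleton_eq_iff)
  moreover have "?e m \<inter> ?e (Suc m) \<noteq> {}" by auto
  ultimately have ee: "f (Inr (?e m)) \<noteq> f (Inr (?e (Suc m)))"
    using tl[unfolded total_labeling_def, THEN conjunct2, THEN conjunct2, THEN conjunct1,
        THEN bspec, OF E[of m], THEN bspec, OF E[of "Suc m"]]
    by blast
  show "admissible (b m) (b (Suc m)) (b (Suc (Suc m)))"
    using pos vv ve ee fe[of m] fe[of "Suc m"] unfolding admissible_def by linarith
  have "finite (edges ?G)" by (simp add: cycle_graph_def)
  moreover have "finite (verts ?G)" by (simp add: cycle_graph_def)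
  ultimately have "finite (f ` (verts ?G <+> edges ?G))" by simp
  from Max_ge[OF this, of "b m"] show "b m \<le> k"
    using V[of m] unfolding M b_def by (simp add: InlI)
qed

lemma admissible_imp_difference_labeling:
  assumes "3 \<le> n"
    and per: "\<And>m. b (m mod n) = b m"
    and adm: "\<And>m. admissible (b m) (b (Suc m)) (b (Suc (Suc m)))"
  shows "\<exists>f. k_total_difference_labeling (Max (b ` {..<n})) (cycle_graph n) f"
proof -
  let ?G = "cycle_graph n"
  let ?e = "\<lambda>m. {m mod n, Suc m mod n}"
  \<comment> \<open>On an edge, maximum minus minimum is the absolute difference, written as a
    function of the unordered pair.\<close>
  define f where "f = case_sum b (\<lambda>e. Max (b ` e) - Min (b ` e))"
  have fv: "f (Inl u) = b u" for u by (simp add: f_def)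
  have fuv: "int (f (Inr {u, v})) = \<bar>int (b u) - int (b v)\<bar>" for u v
    by (simp add: f_def max_def min_def)
  have fe: "int (f (Inr (?e m))) = \<bar>int (b m) - int (b (Suc m))\<bar>" for m
    by (simp only: fuv per)
  have n: "0 < n" using assms by simp
  have E: "\<exists>m. e = ?e m" if "e \<in> edges ?G" for e
    using that by (auto simp: edges_cycle_graph[OF n])
  have V: "verts ?G = {..<n}" by (simp add: cycle_graph_def)
  note adm' = adm[unfolded admissible_def]
  have consecutive: "f (Inr (?e m)) \<noteq> f (Inr (?e (Suc m)))" for m
    using adm'[of m] fe[of m] fe[of "Suc m"] by linarith
  have vertex_edge: "b m \<noteq> f (Inr (?e m))" "b (Suc m) \<noteq> f (Inr (?e m))" for m
    using adm'[of m] conjunct1[OF adm'[of "Suc m"]] fe[of m] by linarith+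
  have pos_edge: "0 < f (Inr (?e m))" for m
    using adm'[of m] fe[of m] by linarith
  have tl: "total_labeling ?G f"
    unfolding total_labeling_def
  proof (intro conjI ballI allI impI)
    fix x assume "x \<in> verts ?G <+> edges ?G"
    then show "0 < f x"
      using adm' pos_edge E by (fastforce simp: fv)
  next
    fix u v assume "{u, v} \<in> edges ?G"
    then obtain m where "{u, v} = ?e m" using E by blast
    moreover have "b (m mod n) \<noteq> b (Suc m mod n)"
      using adm'[of m] by (simp only: per) simp
    ultimately show "f (Inl u) \<noteq> f (Inl v)"
      by (auto simp: fv doubleton_eq_iff)
  next
    fix e e' assume e: "e \<in> edges ?G" "e' \<in> edges ?G" "e \<noteq> e' \<and> e \<inter> e' \<noteq> {}"
    obtain i j where ij: "e = ?e i" "e' = ?e j"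
      using E e by metis
    have shift: "?e m = ?e m'" if "m mod n = m' mod n" for m m'
      using that mod_Suc_eq[of m n] mod_Suc_eq[of m' n] by simp
    have inj: "m mod n = m' mod n" if "Suc m mod n = Suc m' mod n" for m m'
      using that n by (auto simp: mod_Suc split: if_splits)
    \<comment> \<open>A common vertex that starts both edges, or ends both, would make them equal;
      so it ends one and starts the other.\<close>
    have "i mod n = Suc j mod n \<or> j mod n = Suc i mod n"
      using e(3) inj[of i j] shift[of i j] unfolding ij by auto
    then have "e = ?e (Suc j) \<or> e' = ?e (Suc i)"
      unfolding ij using shift by blast
    then show "f (Inr e) \<noteq> f (Inr e')"
      using consecutive ij by metis
  next
    fix e u assume "e \<in> edges ?G" "u \<in> e"
    then obtain m where e: "e = ?e m" and "u = m mod n \<or> u = Suc m mod n"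
      using E by blast
    then have "f (Inl u) = b m \<or> f (Inl u) = b (Suc m)"
      using per fv by auto
    then show "f (Inl u) \<noteq> f (Inr e)"
      using vertex_edge unfolding e by metis
  qed
  \<comment> \<open>An edge label, as a difference of naturals, is at most the larger endpoint
    label, so the vertices alone decide the maximum.\<close>
  have "Max (f ` (verts ?G <+> edges ?G)) = Max (b ` {..<n})"
  proof (rule Max_eqI)
    show "finite (f ` (verts ?G <+> edges ?G))"
      by (simp add: cycle_graph_def)
    have bound: "b m \<le> Max (b ` {..<n})" for m
      using n per[of m] by (intro Max_ge) (auto simp flip: per[of m])
    show "y \<le> Max (b ` {..<n})" if "y \<in> f ` (verts ?G <+> edges ?G)" for y
    proof -
      from that consider u where "y = f (Inl u)" | m where "y = f (Inr (?e m))"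
        using E by blast
      then show ?thesis
      proof cases
        case 1 then show ?thesis using bound by (simp add: fv)
      next
        case 2 then show ?thesis
          using bound[of m] bound[of "Suc m"] fe[of m] by linarith
      qed
    qed
    have "Max (b ` {..<n}) \<in> b ` {..<n}"
      using n by (intro Max_in) auto
    moreover have "b ` {..<n} = f ` Inl ` verts ?G"
      by (simp add: V fv image_image)
    ultimately show "Max (b ` {..<n}) \<in> f ` (verts ?G <+> edges ?G)"
      by (metis UnCI Plus_def image_Un)
  qed
  with tl fuv fv show ?thesis
    unfolding k_total_difference_labeling_def k_total_labeling_def by metis
qed

text \<open>The second window supplies the conditions on the pair \<open>b\<close>,
  \<open>c\<close>, so that \<open>b = 2\<close> would force both \<open>a = 3\<close> and
  \<open>c = 3\<close>.\<close>

lemma admissible_le_4_cases: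
  assumes "admissible a b c" "admissible b c d" "0 < c" and "a \<le> 4" "b \<le> 4" "c \<le> 4"
  shows "b \<in> {1, 3, 4}"
proof -
  have "x = 0 \<or> x = 1 \<or> x = 2 \<or> x = 3 \<or> x = 4" if "x \<le> 4" for x :: nat
    using that by linarith
  from this[OF assms(4)] this[OF assms(5)] this[OF assms(6)] assms(1-3)
  show ?thesis
    unfolding admissible_def by auto
qed

lemma periodic_admissible_le_4:
  assumes per: "\<And>m. b (m + n) = b m" and "0 < n"
    and adm: "\<And>m. admissible (b m) (b (Suc m)) (b (Suc (Suc m)))"
    and le: "\<And>m. b m \<le> 4"
  shows "\<exists>m. b m = 4" and "n mod 3 = 0"
proof -
  note adm' = adm[unfolded admissible_def]
  have vals: "b m \<in> {1, 3, 4}" for m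
  proof -
    \<comment> \<open>To put \<open>m\<close> in the middle, the window starts at its predecessor;
      adding the period \<open>n\<close> avoids truncated subtraction at
      \<open>m = 0\<close>.\<close>
    have "b (Suc (m + n - 1)) \<in> {1, 3, 4}"
      by (rule admissible_le_4_cases[OF adm adm _ le le le]) (use adm' in blast)
    then show ?thesis using \<open>0 < n\<close> per by simp
  qed
  have distinct: "b m \<noteq> b (Suc m)" "b m \<noteq> b (Suc (Suc m))" for m
    using adm'[of m] by auto
  show "\<exists>m. b m = 4"
    using vals[of 0] vals[of 1] vals[of 2] distinct[of 0] distinct[of 1]
    by (auto simp: numeral_2_eq_2)
  \<comment> \<open>Three consecutive labels exhaust \<open>{1, 3, 4}\<close>, so the fourth,
    differing from the second and third, equals the first.\<close>
  have per3: "b (m + 3) = b m" for m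
    using vals[of m] vals[of "Suc m"] vals[of "Suc (Suc m)"] vals[of "m + 3"]
      distinct[of m] distinct[of "Suc m"] distinct[of "Suc (Suc m)"]
    by (auto simp: numeral_3_eq_3)
  have "b (m + 3 * q) = b m" for m q
  proof (induction q)
    case (Suc q)
    then show ?case using per3[of "m + 3 * q"] by (simp add: algebra_simps)
  qed simp
  \<comment> \<open>The periods 3 and \<open>n\<close> give \<open>b (n mod 3) = b n = b 0\<close>;
    a remainder 1 or 2 would contradict \<open>distinct\<close>.\<close>
  from this[of "n mod 3" "n div 3"] have "b (n mod 3) = b 0"
    using per[of 0] by (simp add: mult.commute)
  moreover have "n mod 3 = 0 \<or> n mod 3 = Suc 0 \<or> n mod 3 = Suc (Suc 0)" by linarith
  ultimately show "n mod 3 = 0"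
    using distinct[of 0] by metis
qed

lemma difference_labeling_lower_bound:
  assumes "3 \<le> n" and f: "k_total_difference_labeling k (cycle_graph n) f"
  shows "(if n mod 3 = 0 then 4 else 5) \<le> k"
proof (rule ccontr)
  assume "\<not> ?thesis"
  then have k: "k < (if n mod 3 = 0 then 4 else 5)" by simp
  let ?b = "\<lambda>m. f (Inl (m mod n))"
  have adm: "admissible (?b m) (?b (Suc m)) (?b (Suc (Suc m)))" and le: "?b m \<le> k" for m
    using difference_labeling_imp_admissible[OF assms] by auto
  have le4: "?b m \<le> 4" for m
    using le[of m] k by (simp split: if_splits)
  have "?b (m + n) = ?b m" for m by simp
  then have "\<exists>m. ?b m = 4" "n mod 3 = 0"
    using periodic_admissible_le_4[of ?b n] adm le4 \<open>3 \<le> n\<close> by auto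
  \<comment> \<open>Divisibility by 3 turns the assumed bound into \<open>k < 4\<close>, yet the
    label 4 occurs.\<close>
  then show False using le k by (metis not_le)
qed

text \<open>The pattern \<open>1, 3, 4\<close> is overridden at its end: the last entries
  \<open>4, 1\<close> become \<open>2, 5\<close> for remainder 1, and \<open>4, 1, 3\<close> become
  \<open>2, 5, 4\<close> for remainder 2.\<close>

definition cycle_label :: "nat \<Rightarrow> nat \<Rightarrow> nat" where
  "cycle_label n i =
     (if n mod 3 = 1 \<and> i + 1 = n then 5
      else if n mod 3 = 1 \<and> i + 2 = n then 2
      else if n mod 3 = 2 \<and> i + 1 = n then 4
      else if n mod 3 = 2 \<and> i + 2 = n then 5
      else if n mod 3 = 2 \<and> i + 3 = n then 2
      else if i mod 3 = 0 then 1 else if i mod 3 = 1 then 3 else 4)"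

lemma admissible_cycle_label:
  assumes "3 \<le> n"
  shows "admissible (cycle_label n (m mod n)) (cycle_label n (Suc m mod n))
           (cycle_label n (Suc (Suc m) mod n))"
proof -
  define i where "i = m mod n"
  have i: "i < n" using assms by (simp add: i_def)
  have s: "Suc m mod n = (if Suc i = n then 0 else Suc i)"
    by (simp add: mod_Suc i_def)
  have ss: "Suc (Suc m) mod n =
      (if Suc i = n then 1 else if Suc (Suc i) = n then 0 else Suc (Suc i))"
    using assms s by (simp add: mod_Suc)
  have r: "n mod 3 = 0 \<or> n mod 3 = 1 \<or> n mod 3 = 2" by linarith
  have residues: "i mod 3 = 0 \<and> Suc i mod 3 = 1 \<and> Suc (Suc i) mod 3 = 2 \<or>
      i mod 3 = 1 \<and> Suc i mod 3 = 2 \<and> Suc (Suc i) mod 3 = 0 \<or>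
      i mod 3 = 2 \<and> Suc i mod 3 = 0 \<and> Suc (Suc i) mod 3 = 1"
    by (auto simp: mod_Suc)
  \<comment> \<open>These reduce \<open>n mod 3\<close> to the residues above when \<open>n\<close>
    is \<open>i + 3\<close>, \<open>i + 4\<close> or \<open>i + 5\<close>.\<close>
  have shift: "Suc (Suc (Suc i)) mod 3 = i mod 3" "(4 + i) mod 3 = Suc i mod 3"
      "(5 + i) mod 3 = Suc (Suc i) mod 3"
    by presburger+
  \<comment> \<open>A window covers positions \<open>i\<close> to \<open>i + 2\<close> and at most
    the last three positions are overridden, so for \<open>i + 5 < n\<close> only the repeating
    pattern is seen.\<close>
  consider "n = Suc i" | "n = Suc (Suc i)" | "n = Suc (Suc (Suc i))"
    | "n = Suc (Suc (Suc (Suc i)))" | "n = Suc (Suc (Suc (Suc (Suc i))))"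
    | "Suc (Suc (Suc (Suc (Suc i)))) < n"
    using i by linarith
  then show ?thesis
  proof cases
    case 1
    then show ?thesis unfolding s ss i_def[symmetric] using residues assms
      by (elim disjE) (auto simp: cycle_label_def admissible_def shift)
  next
    case 2
    then show ?thesis unfolding s ss i_def[symmetric] using residues assms
      by (elim disjE) (auto simp: cycle_label_def admissible_def shift)
  next
    case 3
    then show ?thesis unfolding s ss i_def[symmetric] using residues
      by (elim disjE) (auto simp: cycle_label_def admissible_def shift)
  next
    case 4
    then show ?thesis unfolding s ss i_def[symmetric] using residues
      by (elim disjE) (auto simp: cycle_label_def admissible_def shift)
  next
    case 5
    then show ?thesis unfolding s ss i_def[symmetric] using residues
      by (elim disjE) (auto simp: cycle_label_def admissible_def shift)
  next
    case 6
    with r residues show ?thesis unfolding s ss i_def[symmetric]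
      by (elim disjE) (simp_all add: cycle_label_def admissible_def)
  qed
qed

lemma Max_cycle_label:
  assumes "3 \<le> n"
  shows "Max (cycle_label n ` {..<n}) = (if n mod 3 = 0 then 4 else 5)"
proof (rule Max_eqI)
  have "cycle_label n i \<le> (if n mod 3 = 0 then 4 else 5)" for i
    by (simp add: cycle_label_def)
  then show "y \<le> (if n mod 3 = 0 then 4 else 5)" if "y \<in> cycle_label n ` {..<n}" for y
    using that by blast
  \<comment> \<open>The label 4 stands at position 2 when 3 divides \<open>n\<close>; otherwise 5
    stands last (remainder 1) or second to last (remainder 2).\<close>
  consider "n mod 3 = 0" | "n mod 3 = 1" | "n mod 3 = 2" by linarith
  then show "(if n mod 3 = 0 then 4 else 5) \<in> cycle_label n ` {..<n}"
  proof cases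
    case 1
    with assms show ?thesis
      by (intro image_eqI[of _ _ 2]) (simp_all add: cycle_label_def)
  next
    case 2
    with assms show ?thesis
      by (intro image_eqI[of _ _ "n - 1"]) (simp_all add: cycle_label_def)
  next
    case 3
    with assms show ?thesis
      by (intro image_eqI[of _ _ "n - 2"]) (simp_all add: cycle_label_def, arith)
  qed
qed simp

theorem theorem3p2:
  fixes n :: nat
  assumes "n \<ge> 3"
  shows "chi_td (cycle_graph n) = (if n mod 3 = 0 then 4 else 5)"
  unfolding chi_td_def
proof (rule Least_equality)
  \<comment> \<open>Reducing the position modulo \<open>n\<close> makes the explicit labels
    periodic, as the construction requires.\<close>
  let ?b = "\<lambda>m. cycle_label n (m mod n)"
  have "?b ` {..<n} = cycle_label n ` {..<n}" by simp
  then have M: "Max (?b ` {..<n}) = (if n mod 3 = 0 then 4 else 5)"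
    by (simp only: Max_cycle_label[OF assms])
  show "\<exists>f. k_total_difference_labeling (if n mod 3 = 0 then 4 else 5) (cycle_graph n) f"
    unfolding M[symmetric]
    by (rule admissible_imp_difference_labeling[where b = ?b, OF assms _
          admissible_cycle_label[OF assms]]) simp
qed (elim exE, rule difference_labeling_lower_bound[OF assms])

end
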